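(* Let $n\ge 2$. Let $G$ be a finite graph containing a triangle with distinct vertices $v_1,v_2,v_3$ and edges $1,2,3$, where edge $i$ joins the two vertices $v_j,v_k$ with $\{i,j,k\}=\{1,2,3\}$. Let $G'$ be the graph obtained from $G$ by replacing this triangle by a star: the three triangle edges are deleted, a new vertex $v_0$ is added, and three new edges $1,2,3$ are added, edge $i$ joining $v_0$ to $v_i$. For $m=1,2$ let $M_m(G)$ and $M_m(G')$ be anisotropic $n$-Potts models which have the same parameters on all edges outside the triangle/star, whose parameters on the triangle edges are $\alpha_i^m,\beta_i^m$ and on the star edges are $\alpha_i'^m,\beta_i'^m$ ($i=1,2,3$), and suppose that for each $m=1,2$ these are related by the star-triangle transformation. Put $$p_i=\frac{\alpha^1_i-\beta^1_i}{\alpha^2_i-\beta^2_i},\quad q_i=\frac{\alpha^2_i\beta^1_i-\alpha^1_i\beta^2_i}{\alpha^2_i-\beta^2_i},\quad p'_i=\frac{\alpha'^1_i-\beta'^1_i}{\alpha'^2_i-\beta'^2_i},\quad q'_i=\frac{\alpha'^2_i\beta'^1_i-\alpha'^1_i\beta'^2_i}{\alpha'^2_i-\beta'^2_i}$$ (all denominators, and all $q_i,q_i'$, being nonzero), and assume $p_1p_2p_3=p_1'p_2'p_3'$. Then $$q_1q_2q_3\Big(Z^2_n(G_0)+\sum_{i=1}^3\frac{p_i}{q_i}Z^2_n(G_i)+\sum_{1\le i<j\le 3}\frac{p_ip_j}{q_iq_j}Z^2_n(G_{ij})\Big)=q_1'q_2'q_3'\Big(Z^2_n(G'_0)+\sum_{i=1}^3\frac{p'_i}{q'_i}Z^2_n(G'_i)+\sum_{1\le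 i<j\le 3}\frac{p'_ip'_j}{q'_iq'_j}Z^2_n(G'_{ij})\Big),$$ where $Z_n^2$ denotes the partition function with the parameters of the second model.
   Context: Graphs are finite and undirected; loops and multiple edges are allowed. An anisotropic $n$-Potts model on a graph $H=(V,E)$ assigns to each edge $e$ complex parameters $\alpha_e,\beta_e$; its partition function is $Z_n(H)=\sum_{\sigma\colon V\to\mathbb Z_n}\prod_{e\in E} w_e(\sigma)$, where $w_e(\sigma)=\alpha_e$ if $\sigma$ takes equal values at the two ends of $e$ and $w_e(\sigma)=\beta_e$ otherwise. Subgraphs carry the restricted parameters. $G_0,G_i,G_{ij}$ are the spanning subgraphs of $G$ (all vertices kept) obtained by deleting from $G$ all triangle edges except, respectively: none; edge $i$; edges $i$ and $j$. Similarly $G'_0,G'_i,G'_{ij}$ are the spanning subgraphs of $G'$ (all vertices kept, including $v_0$) obtained by deleting all star edges except, respectively: none; edge $i$; edges $i,j$. Triangle parameters $(\alpha_i,\beta_i)$ and star parameters $(\alpha'_i,\beta'_i)$ are related by the star-triangle transformation if the boundary partition functions of the triangle and the star (spins at $v_1,v_2,v_3$ fixed, spin at $v_0$ summed over) coincide for all boundary spins; explicitly, for every $\{i,j,k\}=\{1,2,3\}$, $$\alpha'_i\beta'_j\beta'_k+\beta'_i\alpha'_j\alpha'_k+(n-2)\beta'_1\beta'_2\beta'_3=\alpha_i\beta_j\beta_k,\qquad \alpha_1'\alpha_2'\alpha_3'+(n-1)\beta_1'\beta_2'\beta_3'=\alpha_1\alpha_2\alpha_3,$$ and, when $n\ge3$,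 additionally $\alpha'_1\beta'_2\beta'_3+\beta'_1\alpha'_2\beta'_3+\beta'_1\beta'_2\alpha'_3+(n-3)\beta'_1\beta'_2\beta'_3=\beta_1\beta_2\beta_3$. *)

theory Defs
  imports Complex_Main "HOL-Library.FuncSet" "HOL-Library.Uprod"
begin

text \<open>Undirected multigraphs: each edge has an unordered pair of ends, so that loops
  (\<open>Upair x x\<close>) and parallel edges are allowed.\<close>

record ('v, 'e) multigraph =
  verts :: "'v set"
  edges :: "'e set"
  ends :: "'e \<Rightarrow> 'v uprod"

definition finite_graph :: "('v, 'e) multigraph \<Rightarrow> bool" where
  "finite_graph G \<longleftrightarrow> finite (verts G) \<and> finite (edges G) \<and>
     (\<forall>x\<in>edges G. set_uprod (ends G x) \<subseteq> verts G)"

definition delete_edges :: "('v, 'e) multigraph \<Rightarrow> 'e set \<Rightarrow> ('v, 'e) multigraph" where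
  "delete_edges G D = G\<lparr>edges := edges G - D\<rparr>"

definition edge_weight :: "complex \<Rightarrow> complex \<Rightarrow> ('v \<Rightarrow> nat) \<Rightarrow> 'v uprod \<Rightarrow> complex" where
  "edge_weight a b \<sigma> u = (if \<forall>x\<in>set_uprod u. \<forall>y\<in>set_uprod u. \<sigma> x = \<sigma> y then a else b)"

lemma edge_weight_Upair [simp]:
  "edge_weight a b \<sigma> (Upair x y) = (if \<sigma> x = \<sigma> y then a else b)"
  by (auto simp: edge_weight_def)

text \<open>The spins, elements of the integers modulo \<open>n\<close>, are represented by their residues
  in \<open>{..<n}\<close>; spin configurations are made extensional outside the vertex set so that each
  one is counted once.\<close>

definition potts_Z :: "nat \<Rightarrow> ('e \<Rightarrow> complex) \<Rightarrow> ('e \<Rightarrow> complex) \<Rightarrow> ('v, 'e) multigraph \<Rightarrow> complex" where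
  "potts_Z n \<alpha> \<beta> H =
     (\<Sum>\<sigma>\<in>verts H \<rightarrow>\<^sub>E {..<n}. \<Prod>x\<in>edges H. edge_weight (\<alpha> x) (\<beta> x) \<sigma> (ends H x))"

text \<open>The edge opposite to \<open>v i\<close> carries the label \<open>i\<close>.\<close>

definition is_triangle :: "('v, 'e) multigraph \<Rightarrow> (nat \<Rightarrow> 'v) \<Rightarrow> (nat \<Rightarrow> 'e) \<Rightarrow> bool" where
  "is_triangle G v e \<longleftrightarrow>
     v ` {1..3} \<subseteq> verts G \<and> inj_on v {1..3} \<and> e ` {1..3} \<subseteq> edges G \<and>
     (\<forall>i j k. {i, j, k} = {1..3} \<longrightarrow> ends G (e i) = Upair (v j) (v k))"

text \<open>Here \<open>v0\<close> and the star edges \<open>s i\<close> are meant to be new; the identifiers \<open>s i\<close> may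
  coincide with those of the deleted triangle edges \<open>e i\<close>.\<close>

definition triangle_to_star ::
    "('v, 'e) multigraph \<Rightarrow> (nat \<Rightarrow> 'v) \<Rightarrow> (nat \<Rightarrow> 'e) \<Rightarrow> 'v \<Rightarrow> (nat \<Rightarrow> 'e) \<Rightarrow> ('v, 'e) multigraph" where
  "triangle_to_star G v e v0 s =
     \<lparr>verts = insert v0 (verts G),
      edges = (edges G - e ` {1..3}) \<union> s ` {1..3},
      ends = (ends G)(s 1 := Upair v0 (v 1), s 2 := Upair v0 (v 2), s 3 := Upair v0 (v 3))\<rparr>"

text \<open>Boundary partition functions of the triangle and the star with parameters indexed by
  \<open>{1..3}\<close>; \<open>\<tau> i\<close> is the spin at \<open>v i\<close> and \<open>t\<close> the spin at the centre of the star.\<close>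

definition triangle_boundary_Z ::
    "(nat \<Rightarrow> complex) \<Rightarrow> (nat \<Rightarrow> complex) \<Rightarrow> (nat \<Rightarrow> nat) \<Rightarrow> complex" where
  "triangle_boundary_Z \<alpha> \<beta> \<tau> =
     (if \<tau> 2 = \<tau> 3 then \<alpha> 1 else \<beta> 1) *
     (if \<tau> 1 = \<tau> 3 then \<alpha> 2 else \<beta> 2) *
     (if \<tau> 1 = \<tau> 2 then \<alpha> 3 else \<beta> 3)"

definition star_boundary_Z ::
    "nat \<Rightarrow> (nat \<Rightarrow> complex) \<Rightarrow> (nat \<Rightarrow> complex) \<Rightarrow> (nat \<Rightarrow> nat) \<Rightarrow> complex" where
  "star_boundary_Z n \<alpha>' \<beta>' \<tau> = (\<Sum>t<n. \<Prod>i\<in>{1..3}. if t = \<tau> i then \<alpha>' i else \<beta>' i)"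

definition star_triangle_related ::
    "nat \<Rightarrow> (nat \<Rightarrow> complex) \<Rightarrow> (nat \<Rightarrow> complex) \<Rightarrow> (nat \<Rightarrow> complex) \<Rightarrow> (nat \<Rightarrow> complex) \<Rightarrow> bool" where
  "star_triangle_related n \<alpha> \<beta> \<alpha>' \<beta>' \<longleftrightarrow>
     (\<forall>\<tau>\<in>{1..3} \<rightarrow>\<^sub>E {..<n}. triangle_boundary_Z \<alpha> \<beta> \<tau> = star_boundary_Z n \<alpha>' \<beta>' \<tau>)"

lemma atLeastAtMost_1_3: "{1..3::nat} = {1, 2, 3}"
  by auto

lemma insert3_eq_iff:
  "{i, j, k} = {1..3::nat} \<longleftrightarrow>
     (i, j, k) \<in> {(1, 2, 3), (1, 3, 2), (2, 1, 3), (2, 3, 1), (3, 1, 2), (3, 2, 1)}" (is "?L \<longleftrightarrow> ?R")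
proof
  assume L: ?L
  then have "card {i, j, k} = 3" by simp
  then have "i \<noteq> j" "i \<noteq> k" "j \<noteq> k" by (auto simp: card_insert_if split: if_splits)
  moreover have "i \<in> {1, 2, 3}" "j \<in> {1, 2, 3}" "k \<in> {1, 2, 3}"
    using L unfolding atLeastAtMost_1_3 by blast+
  ultimately show ?R by (elim insertE emptyE) simp_all
next
  assume ?R
  then show ?L unfolding atLeastAtMost_1_3 by (elim insertE emptyE) (simp_all add: insert_commute)
qed

lemma star_boundary_Z_all_equal:
  assumes "\<tau> 1 = a" "\<tau> 2 = a" "\<tau> 3 = a" "a < n"
  shows "star_boundary_Z n A B \<tau> = A 1 * A 2 * A 3 + (of_nat n - 1) * (B 1 * B 2 * B 3)"
proof -
  have "star_boundary_Z n A B \<tau> =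
      (\<Sum>t<n. B 1 * B 2 * B 3 + (if t = a then A 1 * A 2 * A 3 - B 1 * B 2 * B 3 else 0))"
    unfolding star_boundary_Z_def atLeastAtMost_1_3 using assms
    by (intro sum.cong) (auto simp: mult.assoc)
  also have "\<dots> = A 1 * A 2 * A 3 + (of_nat n - 1) * (B 1 * B 2 * B 3)"
    using assms by (simp add: sum.distrib algebra_simps)
  finally show ?thesis .
qed

lemma star_boundary_Z_two_equal:
  assumes "{i, j, k} = {1..3}" "\<tau> i = a" "\<tau> j = b" "\<tau> k = b" "a \<noteq> b" "a < n" "b < n"
  shows "star_boundary_Z n A B \<tau> =
    A i * B j * B k + B i * A j * A k + (of_nat n - 2) * (B 1 * B 2 * B 3)"
proof -
  have "star_boundary_Z n A B \<tau> =
      (\<Sum>t<n. B 1 * B 2 * B 3 + (if t = a then A i * B j * B k - B 1 * B 2 * B 3 else 0)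
         + (if t = b then B i * A j * A k - B 1 * B 2 * B 3 else 0))"
    unfolding star_boundary_Z_def atLeastAtMost_1_3
  proof (rule sum.cong[OF refl])
    fix t
    show "(\<Prod>i\<in>{1, 2, 3}. if t = \<tau> i then A i else B i) =
      B 1 * B 2 * B 3 + (if t = a then A i * B j * B k - B 1 * B 2 * B 3 else 0)
         + (if t = b then B i * A j * A k - B 1 * B 2 * B 3 else 0)"
      using assms(1)[unfolded insert3_eq_iff] assms(2-5)
      by (elim insertE emptyE) (simp_all add: mult.commute mult.left_commute)
  qed
  also have "\<dots> = A i * B j * B k + B i * A j * A k + (of_nat n - 2) * (B 1 * B 2 * B 3)"
    using assms by (simp add: sum.distrib algebra_simps)
  finally show ?thesis .
qed

lemma star_boundary_Z_distinct:
  assumes "\<tau> 1 = a" "\<tau> 2 = b" "\<tau> 3 = c" "a \<noteq> b" "a \<noteq> c" "b \<noteq> c" "a < n" "b < n" "c < n"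
  shows "star_boundary_Z n A B \<tau> = A 1 * B 2 * B 3 + B 1 * A 2 * B 3 + B 1 * B 2 * A 3
    + (of_nat n - 3) * (B 1 * B 2 * B 3)"
proof -
  have "star_boundary_Z n A B \<tau> =
      (\<Sum>t<n. B 1 * B 2 * B 3 + (if t = a then A 1 * B 2 * B 3 - B 1 * B 2 * B 3 else 0)
         + (if t = b then B 1 * A 2 * B 3 - B 1 * B 2 * B 3 else 0)
         + (if t = c then B 1 * B 2 * A 3 - B 1 * B 2 * B 3 else 0))"
    unfolding star_boundary_Z_def atLeastAtMost_1_3 using assms
    by (intro sum.cong) (auto simp: algebra_simps)
  also have "\<dots> = A 1 * B 2 * B 3 + B 1 * A 2 * B 3 + B 1 * B 2 * A 3
      + (of_nat n - 3) * (B 1 * B 2 * B 3)"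
    using assms by (simp add: sum.distrib algebra_simps)
  finally show ?thesis .
qed

text \<open>The star-triangle relation written out as equations between the parameters.\<close>

lemma star_triangle_related_iff:
  assumes "n \<ge> 2"
  shows "star_triangle_related n \<alpha> \<beta> \<alpha>' \<beta>' \<longleftrightarrow>
    (\<forall>i j k. {i, j, k} = {1..3} \<longrightarrow>
       \<alpha>' i * \<beta>' j * \<beta>' k + \<beta>' i * \<alpha>' j * \<alpha>' k + (of_nat n - 2) * (\<beta>' 1 * \<beta>' 2 * \<beta>' 3)
         = \<alpha> i * \<beta> j * \<beta> k) \<and>
    \<alpha>' 1 * \<alpha>' 2 * \<alpha>' 3 + (of_nat n - 1) * (\<beta>' 1 * \<beta>' 2 * \<beta>' 3) = \<alpha> 1 * \<alpha> 2 * \<alpha> 3 \<and>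
    (n \<ge> 3 \<longrightarrow>
       \<alpha>' 1 * \<beta>' 2 * \<beta>' 3 + \<beta>' 1 * \<alpha>' 2 * \<beta>' 3 + \<beta>' 1 * \<beta>' 2 * \<alpha>' 3
         + (of_nat n - 3) * (\<beta>' 1 * \<beta>' 2 * \<beta>' 3) = \<beta> 1 * \<beta> 2 * \<beta> 3)"
    (is "?L \<longleftrightarrow> ?R1 \<and> ?R2 \<and> ?R3")
proof
  assume L: ?L
  let ?s = "\<lambda>f. restrict f {1..3::nat}"
  have L': "triangle_boundary_Z \<alpha> \<beta> (?s f) = star_boundary_Z n \<alpha>' \<beta>' (?s f)"
    if "\<And>i. i \<in> {1..3} \<Longrightarrow> f i < n" for f
    using L that unfolding star_triangle_related_def by (auto simp: PiE_def Pi_def)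
  have ?R1
  proof (intro allI impI)
    fix i j k :: nat assume ijk: "{i, j, k} = {1..3}"
    let ?f = "\<lambda>l. if l = i then 0 else 1 :: nat"
    have mem: "i \<in> {1..3}" "j \<in> {1..3}" "k \<in> {1..3}" using ijk by blast+
    have ne: "i \<noteq> j" "i \<noteq> k" using ijk unfolding insert3_eq_iff by auto
    have "star_boundary_Z n \<alpha>' \<beta>' (?s ?f) = \<alpha>' i * \<beta>' j * \<beta>' k + \<beta>' i * \<alpha>' j * \<alpha>' k
        + (of_nat n - 2) * (\<beta>' 1 * \<beta>' 2 * \<beta>' 3)"
      using assms ijk mem ne by (intro star_boundary_Z_two_equal[where a = 0 and b = 1]) auto
    moreover have "triangle_boundary_Z \<alpha> \<beta> (?s ?f) = \<alpha> i * \<beta> j * \<beta> k"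
      using ijk[unfolded insert3_eq_iff]
      by (elim insertE emptyE) (simp_all add: triangle_boundary_Z_def)
    ultimately show "\<alpha>' i * \<beta>' j * \<beta>' k + \<beta>' i * \<alpha>' j * \<alpha>' k
        + (of_nat n - 2) * (\<beta>' 1 * \<beta>' 2 * \<beta>' 3) = \<alpha> i * \<beta> j * \<beta> k"
      using L'[of ?f] assms by simp
  qed
  moreover have ?R2
    using L'[of "\<lambda>_. 0"] assms star_boundary_Z_all_equal[of "?s (\<lambda>_. 0)" 0 n \<alpha>' \<beta>']
    by (simp add: triangle_boundary_Z_def)
  moreover have ?R3
  proof
    assume n: "n \<ge> 3"
    let ?f = "\<lambda>l. l - 1 :: nat"
    have lt: "?f l < n" if "l \<in> {1..3}" for l using that n by auto
    show "\<alpha>' 1 * \<beta>' 2 * \<beta>' 3 + \<beta>' 1 * \<alpha>' 2 * \<beta>' 3 + \<beta>' 1 * \<beta>' 2 * \<alpha>' 3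
         + (of_nat n - 3) * (\<beta>' 1 * \<beta>' 2 * \<beta>' 3) = \<beta> 1 * \<beta> 2 * \<beta> 3"
      using L'[of ?f, OF lt] n star_boundary_Z_distinct[of "?s ?f" 0 1 2 n \<alpha>' \<beta>']
      by (simp add: triangle_boundary_Z_def)
  qed
  ultimately show "?R1 \<and> ?R2 \<and> ?R3" by blast
next
  assume R: "?R1 \<and> ?R2 \<and> ?R3"
  then have R1: ?R1 and R2: ?R2 and R3: ?R3 by blast+
  show ?L unfolding star_triangle_related_def
  proof
    fix \<tau> :: "nat \<Rightarrow> nat" assume "\<tau> \<in> {1..3} \<rightarrow>\<^sub>E {..<n}"
    then have lt: "\<tau> 1 < n" "\<tau> 2 < n" "\<tau> 3 < n" by (auto simp: PiE_def Pi_def)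
    have two: "star_boundary_Z n \<alpha>' \<beta>' \<tau> = \<alpha> i * \<beta> j * \<beta> k"
      if ijk: "{i, j, k} = {1..3}" and "\<tau> i \<noteq> \<tau> j" "\<tau> j = \<tau> k" for i j k
    proof -
      have "\<tau> i < n" "\<tau> j < n" using ijk lt unfolding insert3_eq_iff by auto
      with star_boundary_Z_two_equal[OF ijk refl refl that(3)[symmetric] that(2)]
      show ?thesis using R1 ijk by metis
    qed
    consider "\<tau> 1 = \<tau> 2" "\<tau> 2 = \<tau> 3" | "\<tau> 1 \<noteq> \<tau> 2" "\<tau> 2 = \<tau> 3" | "\<tau> 2 \<noteq> \<tau> 1" "\<tau> 1 = \<tau> 3"
      | "\<tau> 3 \<noteq> \<tau> 1" "\<tau> 1 = \<tau> 2" | "\<tau> 1 \<noteq> \<tau> 2" "\<tau> 2 \<noteq> \<tau> 3" "\<tau> 1 \<noteq> \<tau> 3"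
      by metis
    then show "triangle_boundary_Z \<alpha> \<beta> \<tau> = star_boundary_Z n \<alpha>' \<beta>' \<tau>"
    proof cases
      case 1
      then show ?thesis
        using star_boundary_Z_all_equal[OF refl 1(1)[symmetric] trans[OF 1 , symmetric] lt(1), of \<alpha>' \<beta>'] R2
        by (simp add: triangle_boundary_Z_def)
    next
      case 2
      have "{1, 2, 3} = {1..3::nat}" unfolding insert3_eq_iff by simp
      from two[OF this 2] show ?thesis using 2 by (simp add: triangle_boundary_Z_def)
    next
      case 3
      have "{2, 1, 3} = {1..3::nat}" unfolding insert3_eq_iff by simp
      from two[OF this 3] show ?thesis using 3 by (simp add: triangle_boundary_Z_def)
    next
      case 4
      have "{3, 1, 2} = {1..3::nat}" unfolding insert3_eq_iff by simp
      from two[OF this 4] show ?thesis using 4 by (simp add: triangle_boundary_Z_def)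
    next
      case 5
      then have "n \<ge> 3" using lt by auto
      then show ?thesis
        using star_boundary_Z_distinct[OF refl refl refl 5(1,3,2) lt, of \<alpha>' \<beta>'] 5 R3
        by (simp add: triangle_boundary_Z_def)
    qed
  qed
qed

end

theory Submission
  imports Defs
begin

text \<open>The numbers \<open>p\<^sub>i\<close>, \<open>q\<^sub>i\<close> are chosen so that the edge weights of the first model are
  \<open>w\<^sup>1 = p\<^sub>i w\<^sup>2 + q\<^sub>i\<close>. Expanding \<open>\<Prod>(p\<^sub>i w\<^sup>2\<^sub>i + q\<^sub>i)\<close> over the triangle shows that the
  left-hand side is the sum over all spin configurations of the second-model weight of the edges
  outside the triangle times \<open>\<Prod>w\<^sup>1\<^sub>i - p\<^sub>1 p\<^sub>2 p\<^sub>3 \<Prod>w\<^sup>2\<^sub>i\<close>, and likewise for the star. After summing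
  over the spin at the centre of the star, both products agree by the star-triangle relation.\<close>

lemma finite_graph_endsD:
  assumes "finite_graph G" "x \<in> edges G" "a \<in> set_uprod (ends G x)"
  shows "a \<in> verts G"
  using assms unfolding finite_graph_def by blast

lemma edge_weight_cong:
  assumes "\<And>a. a \<in> set_uprod u \<Longrightarrow> \<sigma> a = \<tau> a"
  shows "edge_weight a b \<sigma> u = edge_weight a b \<tau> u"
  using assms unfolding edge_weight_def by simp

text \<open>An edge weight takes only two values, so an affine relation between both pairs of
  parameters carries over to the weights for every \<open>\<sigma>\<close>.\<close>

lemma edge_weight_affine:
  assumes "a1 = p * a2 + q" "b1 = p * b2 + q"
  shows "edge_weight a1 b1 \<sigma> u = p * edge_weight a2 b2 \<sigma> u + q"
  unfolding edge_weight_def assms by (rule if_distrib[symmetric, where f = "\<lambda>x. p * x + q"])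

text \<open>The map \<open>x \<mapsto> p * x + q\<close> is the line through the points
  \<open>(a2, a1)\<close> and \<open>(b2, b1)\<close>; it exists because \<open>a2\<close> and
  \<open>b2\<close> differ.\<close>

lemma affine_weight_coeffs:
  fixes a1 a2 b1 b2 :: complex
  assumes "a2 - b2 \<noteq> 0" "p = (a1 - b1) / (a2 - b2)" "q = (a2 * b1 - a1 * b2) / (a2 - b2)"
  shows "a1 = p * a2 + q" "b1 = p * b2 + q"
proof -
  have "p * (a2 - b2) = a1 - b1" "q * (a2 - b2) = a2 * b1 - a1 * b2"
    using assms by simp_all
  \<comment> \<open>Multiplied by \<open>a2 - b2\<close>, the claims are polynomial consequences of
    the two equations above; the nonzero factor is cancelled afterwards.\<close>
  then have "(a2 - b2) * a1 = (a2 - b2) * (p * a2 + q)" "(a2 - b2) * b1 = (a2 - b2) * (p * b2 + q)"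
    by algebra+
  then show "a1 = p * a2 + q" "b1 = p * b2 + q"
    using assms(1) by (simp_all only: mult_cancel_left simp_thms)
qed

lemma potts_Z_delete_edges_image:
  fixes A B :: "'e \<Rightarrow> complex"
  assumes "finite (edges H)" "finite I" "inj_on f I" "f ` I \<subseteq> edges H" "K \<subseteq> I"
  shows "potts_Z n A B (delete_edges H (f ` (I - K))) =
    (\<Sum>\<sigma>\<in>verts H \<rightarrow>\<^sub>E {..<n}.
       (\<Prod>x\<in>edges H - f ` I. edge_weight (A x) (B x) \<sigma> (ends H x)) *
       (\<Prod>i\<in>K. edge_weight (A (f i)) (B (f i)) \<sigma> (ends H (f i))))"
proof -
  have split: "edges H - f ` (I - K) = (edges H - f ` I) \<union> f ` K"
    using inj_on_image_set_diff[OF assms(3) Diff_subset assms(5)] assms(4,5) by blast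
  have K: "finite (f ` K)" "inj_on f K" "(edges H - f ` I) \<inter> f ` K = {}"
    using finite_subset[OF assms(5,2)] inj_on_subset[OF assms(3,5)] assms(5) by auto
  have "(\<Prod>x\<in>edges H - f ` (I - K). g x) = (\<Prod>x\<in>edges H - f ` I. g x) * (\<Prod>i\<in>K. g (f i))"
    for g :: "'e \<Rightarrow> complex"
    unfolding split
    by (subst prod.union_disjoint) (use assms(1) K in \<open>simp_all add: prod.reindex\<close>)
  then show ?thesis
    unfolding potts_Z_def delete_edges_def by simp
qed

text \<open>Here \<open>r\<close> is the weight of the outer edges and \<open>x1\<close>,
  \<open>x2\<close>, \<open>x3\<close> are the weights of the special ones. The left-hand side
  collects all terms of the expanded product except the cubic one, which is subtracted on the
  right.\<close>

lemma affine_product_expansion: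
  fixes q1 q2 q3 :: complex
  assumes "q1 \<noteq> 0" "q2 \<noteq> 0" "q3 \<noteq> 0"
  shows "q1 * q2 * q3 *
      (r + (p1 / q1 * (r * x1) + p2 / q2 * (r * x2) + p3 / q3 * (r * x3))
       + (p1 * p2 / (q1 * q2) * (r * (x1 * x2)) + p1 * p3 / (q1 * q3) * (r * (x1 * x3))
          + p2 * p3 / (q2 * q3) * (r * (x2 * x3)))) =
    r * ((p1 * x1 + q1) * (p2 * x2 + q2) * (p3 * x3 + q3) - p1 * p2 * p3 * (x1 * x2 * x3))"
proof -
  \<comment> \<open>In terms of the ratios and the \<open>q\<close>'s the identity has no
    denominators left, so \<open>algebra\<close> can decide it.\<close>
  define c1 c2 c3 where "c1 = p1 / q1" and "c2 = p2 / q2" and "c3 = p3 / q3"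
  then have p: "p1 = c1 * q1" "p2 = c2 * q2" "p3 = c3 * q3" using assms by simp_all
  have c: "p1 / q1 = c1" "p2 / q2 = c2" "p3 / q3 = c3" "p1 * p2 / (q1 * q2) = c1 * c2"
    "p1 * p3 / (q1 * q3) = c1 * c3" "p2 * p3 / (q2 * q3) = c2 * c3"
    unfolding c1_def c2_def c3_def by simp_all
  show ?thesis unfolding c unfolding p by algebra
qed

text \<open>Used for the triangle with \<open>f = e\<close> and for the star with
  \<open>f = s\<close>; \<open>A1\<close> and \<open>B1\<close> are the parameters of the first
  model. The expansion is applied to each configuration separately.\<close>

lemma affine_expansion:
  fixes A B :: "'e \<Rightarrow> complex"
  assumes "finite (edges H)" "inj_on f {1..3}" "f ` {1..3} \<subseteq> edges H"
    and "\<And>i. i \<in> {1..3} \<Longrightarrow> A1 (f i) = p i * A (f i) + q i"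
    and "\<And>i. i \<in> {1..3} \<Longrightarrow> B1 (f i) = p i * B (f i) + q i"
    and "\<And>i. i \<in> {1..3::nat} \<Longrightarrow> q i \<noteq> 0"
  shows "q 1 * q 2 * q 3 *
       (potts_Z n A B (delete_edges H (f ` {1..3}))
        + (\<Sum>i=1..3. p i / q i * potts_Z n A B (delete_edges H (f ` ({1..3} - {i}))))
        + (\<Sum>i=1..3. \<Sum>j=i+1..3. (p i * p j) / (q i * q j) *
             potts_Z n A B (delete_edges H (f ` ({1..3} - {i, j}))))) =
    (\<Sum>\<sigma>\<in>verts H \<rightarrow>\<^sub>E {..<n}.
       (\<Prod>x\<in>edges H - f ` {1..3}. edge_weight (A x) (B x) \<sigma> (ends H x)) *
       ((\<Prod>i\<in>{1..3}. edge_weight (A1 (f i)) (B1 (f i)) \<sigma> (ends H (f i))) -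
        p 1 * p 2 * p 3 * (\<Prod>i\<in>{1..3}. edge_weight (A (f i)) (B (f i)) \<sigma> (ends H (f i)))))"
proof -
  define R where "R \<sigma> = (\<Prod>x\<in>edges H - f ` {1..3}. edge_weight (A x) (B x) \<sigma> (ends H x))" for \<sigma>
  define w where "w i \<sigma> = edge_weight (A (f i)) (B (f i)) \<sigma> (ends H (f i))" for i \<sigma>
  define S where "S = verts H \<rightarrow>\<^sub>E {..<n}"
  have Z: "potts_Z n A B (delete_edges H (f ` ({1..3} - K))) = (\<Sum>\<sigma>\<in>S. R \<sigma> * (\<Prod>i\<in>K. w i \<sigma>))"
    if "K \<subseteq> {1..3}" for K
    using potts_Z_delete_edges_image[OF assms(1) _ assms(2,3) that, of n A B]
    by (simp add: R_def w_def S_def)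
  have Z0: "potts_Z n A B (delete_edges H (f ` {1..3})) = (\<Sum>\<sigma>\<in>S. R \<sigma>)"
    using Z[of "{}"] by simp
  have w1: "edge_weight (A1 (f i)) (B1 (f i)) \<sigma> (ends H (f i)) = p i * w i \<sigma> + q i"
    if "i \<in> {1..3}" for i \<sigma>
    unfolding w_def using that assms(4,5) by (intro edge_weight_affine) auto
  have q: "q 1 \<noteq> 0" "q 2 \<noteq> 0" "q 3 \<noteq> 0" using assms(6) by auto
  have triple: "(\<Sum>i=1..3. g i) = g 1 + g 2 + g 3" "(\<Prod>i\<in>{1..3}. g i) = g 1 * g 2 * g 3"
    for g :: "nat \<Rightarrow> complex"
    unfolding atLeastAtMost_1_3 by (simp_all add: add.assoc mult.assoc)
  \<comment> \<open>For \<open>i = 3\<close> the inner range is empty, which leaves exactly the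
    pairs with \<open>i < j\<close>.\<close>
  have pairs: "(\<Sum>i=1..3. \<Sum>j=i+1..3. g i j) = g 1 2 + g 1 3 + g 2 3"
    for g :: "nat \<Rightarrow> nat \<Rightarrow> complex"
    by (simp add: numeral_3_eq_3 numeral_2_eq_2)
  have "q 1 * q 2 * q 3 *
      ((\<Sum>\<sigma>\<in>S. R \<sigma>)
       + (p 1 / q 1 * (\<Sum>\<sigma>\<in>S. R \<sigma> * w 1 \<sigma>) + p 2 / q 2 * (\<Sum>\<sigma>\<in>S. R \<sigma> * w 2 \<sigma>)
          + p 3 / q 3 * (\<Sum>\<sigma>\<in>S. R \<sigma> * w 3 \<sigma>))
       + ((p 1 * p 2) / (q 1 * q 2) * (\<Sum>\<sigma>\<in>S. R \<sigma> * (w 1 \<sigma> * w 2 \<sigma>))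
          + (p 1 * p 3) / (q 1 * q 3) * (\<Sum>\<sigma>\<in>S. R \<sigma> * (w 1 \<sigma> * w 3 \<sigma>))
          + (p 2 * p 3) / (q 2 * q 3) * (\<Sum>\<sigma>\<in>S. R \<sigma> * (w 2 \<sigma> * w 3 \<sigma>)))) =
      (\<Sum>\<sigma>\<in>S. R \<sigma> * ((p 1 * w 1 \<sigma> + q 1) * (p 2 * w 2 \<sigma> + q 2) * (p 3 * w 3 \<sigma> + q 3)
         - p 1 * p 2 * p 3 * (w 1 \<sigma> * w 2 \<sigma> * w 3 \<sigma>)))"
    unfolding sum_distrib_left sum.distrib[symmetric]
    by (intro sum.cong refl affine_product_expansion q)
  then show ?thesis
    unfolding pairs Z0 S_def[symmetric] R_def[symmetric] triple
    \<comment> \<open>Keeping \<open>1\<close> from becoming \<open>Suc 0\<close> lets the indices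
      match those in the identity just shown.\<close>
    by (simp add: w1 Z w_def[symmetric] del: One_nat_def)
qed

text \<open>A configuration on \<open>insert a V\<close> is uniquely a configuration on
  \<open>V\<close> together with a spin at \<open>a\<close>. This splits off the spin at the centre
  of the star.\<close>

lemma sum_PiE_insert:
  fixes h :: "('a \<Rightarrow> 'b) \<Rightarrow> 'c::comm_monoid_add"
  assumes "a \<notin> V"
  shows "(\<Sum>\<sigma>\<in>insert a V \<rightarrow>\<^sub>E T. h \<sigma>) = (\<Sum>\<sigma>\<in>V \<rightarrow>\<^sub>E T. \<Sum>t\<in>T. h (\<sigma>(a := t)))"
proof -
  have "(\<Sum>\<sigma>\<in>insert a V \<rightarrow>\<^sub>E T. h \<sigma>) = (\<Sum>(t, \<sigma>)\<in>T \<times> (V \<rightarrow>\<^sub>E T). h (\<sigma>(a := t)))"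
    unfolding PiE_insert_eq using inj_combinator[OF assms, of "\<lambda>_. T"]
    by (simp add: sum.reindex split_def)
  also have "\<dots> = (\<Sum>t\<in>T. \<Sum>\<sigma>\<in>V \<rightarrow>\<^sub>E T. h (\<sigma>(a := t)))"
    by (simp add: sum.cartesian_product)
  also have "\<dots> = (\<Sum>\<sigma>\<in>V \<rightarrow>\<^sub>E T. \<Sum>t\<in>T. h (\<sigma>(a := t)))"
    by (rule sum.swap)
  finally show ?thesis .
qed

lemma is_triangle_ends:
  assumes "is_triangle G v e"
  shows "ends G (e 1) = Upair (v 2) (v 3)" "ends G (e 2) = Upair (v 1) (v 3)"
    "ends G (e 3) = Upair (v 1) (v 2)"
proof -
  have ends: "ends G (e i) = Upair (v j) (v k)" if "{i, j, k} = {1..3}" for i j k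
    using assms that unfolding is_triangle_def by blast
  show "ends G (e 1) = Upair (v 2) (v 3)" "ends G (e 2) = Upair (v 1) (v 3)"
    "ends G (e 3) = Upair (v 1) (v 2)"
    by (rule ends, simp only: insert3_eq_iff, simp)+
qed

text \<open>The three vertices are distinct, so the edges differ already in their pairs of
  ends.\<close>

lemma is_triangle_inj:
  assumes "is_triangle G v e"
  shows "inj_on e {1..3}"
proof -
  have "v 1 \<noteq> v 2" "v 1 \<noteq> v 3" "v 2 \<noteq> v 3"
    using assms unfolding is_triangle_def atLeastAtMost_1_3 by auto
  then have "ends G (e 1) \<noteq> ends G (e 2)" "ends G (e 1) \<noteq> ends G (e 3)"
    "ends G (e 2) \<noteq> ends G (e 3)"
    unfolding is_triangle_ends[OF assms] by auto
  then show ?thesis unfolding atLeastAtMost_1_3 by auto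
qed

theorem theorem5p1:
  fixes n :: nat
    and G G' :: "('v, 'e) multigraph"
    and v :: "nat \<Rightarrow> 'v" and v0 :: 'v
    and e s :: "nat \<Rightarrow> 'e"
    and \<alpha> \<beta> \<alpha>' \<beta>' :: "nat \<Rightarrow> 'e \<Rightarrow> complex"
    and p q p' q' :: "nat \<Rightarrow> complex"
  assumes "n \<ge> 2"
    and "finite_graph G"
    and "is_triangle G v e"
    and "v0 \<notin> verts G"
    and "inj_on s {1..3}"
    and "s ` {1..3} \<inter> (edges G - e ` {1..3}) = {}"
    and "G' = triangle_to_star G v e v0 s"
    and "\<And>m x. m \<in> {1, 2} \<Longrightarrow> x \<in> edges G - e ` {1..3} \<Longrightarrow> \<alpha> m x = \<alpha>' m x \<and> \<beta> m x = \<beta>' m x"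
    and "\<And>m. m \<in> {1, 2} \<Longrightarrow> star_triangle_related n
           (\<lambda>i. \<alpha> m (e i)) (\<lambda>i. \<beta> m (e i)) (\<lambda>i. \<alpha>' m (s i)) (\<lambda>i. \<beta>' m (s i))"
    and "\<And>i. i \<in> {1..3} \<Longrightarrow> \<alpha> 2 (e i) - \<beta> 2 (e i) \<noteq> 0"
    and "\<And>i. i \<in> {1..3} \<Longrightarrow> \<alpha>' 2 (s i) - \<beta>' 2 (s i) \<noteq> 0"
    and "\<And>i. i \<in> {1..3} \<Longrightarrow>
           p i = (\<alpha> 1 (e i) - \<beta> 1 (e i)) / (\<alpha> 2 (e i) - \<beta> 2 (e i))"
    and "\<And>i. i \<in> {1..3} \<Longrightarrow>
           q i = (\<alpha> 2 (e i) * \<beta> 1 (e i) - \<alpha> 1 (e i) * \<beta> 2 (e i)) / (\<alpha> 2 (e i) - \<beta> 2 (e i))"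
    and "\<And>i. i \<in> {1..3} \<Longrightarrow>
           p' i = (\<alpha>' 1 (s i) - \<beta>' 1 (s i)) / (\<alpha>' 2 (s i) - \<beta>' 2 (s i))"
    and "\<And>i. i \<in> {1..3} \<Longrightarrow>
           q' i = (\<alpha>' 2 (s i) * \<beta>' 1 (s i) - \<alpha>' 1 (s i) * \<beta>' 2 (s i)) / (\<alpha>' 2 (s i) - \<beta>' 2 (s i))"
    and "\<And>i. i \<in> {1..3} \<Longrightarrow> q i \<noteq> 0"
    and "\<And>i. i \<in> {1..3} \<Longrightarrow> q' i \<noteq> 0"
    and "p 1 * p 2 * p 3 = p' 1 * p' 2 * p' 3"
  shows
    "q 1 * q 2 * q 3 *
       (potts_Z n (\<alpha> 2) (\<beta> 2) (delete_edges G (e ` {1..3}))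
        + (\<Sum>i=1..3. p i / q i * potts_Z n (\<alpha> 2) (\<beta> 2) (delete_edges G (e ` ({1..3} - {i}))))
        + (\<Sum>i=1..3. \<Sum>j=i+1..3. (p i * p j) / (q i * q j) *
             potts_Z n (\<alpha> 2) (\<beta> 2) (delete_edges G (e ` ({1..3} - {i, j}))))) =
     q' 1 * q' 2 * q' 3 *
       (potts_Z n (\<alpha>' 2) (\<beta>' 2) (delete_edges G' (s ` {1..3}))
        + (\<Sum>i=1..3. p' i / q' i * potts_Z n (\<alpha>' 2) (\<beta>' 2) (delete_edges G' (s ` ({1..3} - {i}))))
        + (\<Sum>i=1..3. \<Sum>j=i+1..3. (p' i * p' j) / (q' i * q' j) *
             potts_Z n (\<alpha>' 2) (\<beta>' 2) (delete_edges G' (s ` ({1..3} - {i, j})))))"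
    (is "?L = ?R")
proof -
  note fin = assms(2) and tri = assms(3) and v0 = assms(4) and inj_s = assms(5)
    and s_new = assms(6) and G' = assms(7) and outer = assms(8)
  \<comment> \<open>\<open>E\<close> holds the outer edges shared by both graphs and
    \<open>R\<close> their weight in the second model; \<open>T m\<close> and \<open>Y m\<close> are
    the weights of the triangle and the star in model \<open>m\<close>, the latter before summation
    over the centre.\<close>
  define E where "E = edges G - e ` {1..3}"
  define S where "S = verts G \<rightarrow>\<^sub>E {..<n}"
  define R where "R \<sigma> = (\<Prod>x\<in>E. edge_weight (\<alpha> 2 x) (\<beta> 2 x) \<sigma> (ends G x))" for \<sigma>
  define T where "T m \<sigma> = triangle_boundary_Z (\<lambda>i. \<alpha> m (e i)) (\<lambda>i. \<beta> m (e i)) (\<lambda>i. \<sigma> (v i))" for m \<sigma>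
  define Y where "Y m \<sigma> =
    (\<Prod>i\<in>{1..3}. edge_weight (\<alpha>' m (s i)) (\<beta>' m (s i)) \<sigma> (ends G' (s i)))" for m \<sigma>
  have finG: "finite (verts G)" "finite (edges G)" using fin unfolding finite_graph_def by auto
  have v_mem: "v i \<in> verts G" if "i \<in> {1..3}" for i using tri that unfolding is_triangle_def by blast
  have v_ne: "v i \<noteq> v0" if "i \<in> {1..3}" for i using v_mem[OF that] v0 by auto
  have s_ne: "s 1 \<noteq> s 2" "s 1 \<noteq> s 3" "s 2 \<noteq> s 3"
    using inj_s unfolding atLeastAtMost_1_3 by auto
  have G'_simps: "verts G' = insert v0 (verts G)" "edges G' = E \<union> s ` {1..3}"
    "edges G' - s ` {1..3} = E"
    using s_new unfolding G' triangle_to_star_def E_def by auto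
  have finG': "finite (edges G')" "s ` {1..3} \<subseteq> edges G'"
    using finG unfolding G'_simps(2) E_def by simp_all
  have ends_s: "ends G' (s i) = Upair v0 (v i)" if "i \<in> {1..3}" for i
    using that s_ne unfolding G' triangle_to_star_def atLeastAtMost_1_3 by auto
  \<comment> \<open>The star labels avoid \<open>E\<close>, so the updates of \<open>ends\<close> do
    not reach the outer edges, even if a star edge reuses the label of a triangle edge.\<close>
  have ends_E: "ends G' x = ends G x" if "x \<in> E" for x
    using that s_new unfolding G' triangle_to_star_def E_def atLeastAtMost_1_3 by auto
  have star: "(\<Sum>t<n. Y m (\<sigma>(v0 := t))) = T m \<sigma>" if "\<sigma> \<in> S" "m \<in> {1, 2}" for m \<sigma>
  proof -
    \<comment> \<open>The star-triangle relation speaks of extensional boundary spins, hence the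
      restriction to \<open>{1..3}\<close>.\<close>
    let ?\<tau> = "restrict (\<lambda>i. \<sigma> (v i)) {1..3}"
    have "?\<tau> \<in> {1..3} \<rightarrow>\<^sub>E {..<n}"
      using that(1) v_mem unfolding S_def by auto
    then have "triangle_boundary_Z (\<lambda>i. \<alpha> m (e i)) (\<lambda>i. \<beta> m (e i)) ?\<tau> =
        star_boundary_Z n (\<lambda>i. \<alpha>' m (s i)) (\<lambda>i. \<beta>' m (s i)) ?\<tau>"
      using assms(9)[OF that(2)] unfolding star_triangle_related_def by blast
    moreover have "T m \<sigma> = triangle_boundary_Z (\<lambda>i. \<alpha> m (e i)) (\<lambda>i. \<beta> m (e i)) ?\<tau>"
      unfolding T_def triangle_boundary_Z_def by simp
    moreover have "(\<Sum>t<n. Y m (\<sigma>(v0 := t))) =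
        star_boundary_Z n (\<lambda>i. \<alpha>' m (s i)) (\<lambda>i. \<beta>' m (s i)) ?\<tau>"
      unfolding Y_def star_boundary_Z_def
      by (intro sum.cong prod.cong refl) (simp add: ends_s v_ne)
    ultimately show ?thesis by simp
  qed
  have triangle: "(\<Prod>i\<in>{1..3}. edge_weight (\<alpha> m (e i)) (\<beta> m (e i)) \<sigma> (ends G (e i))) = T m \<sigma>"
    for m \<sigma>
    unfolding T_def triangle_boundary_Z_def atLeastAtMost_1_3
    by (simp add: is_triangle_ends[OF tri, simplified] mult.assoc)
  \<comment> \<open>No outer edge ends at \<open>v0\<close>, and the parameters agree on
    \<open>E\<close>; so the outer weight is independent of the spin at the centre.\<close>
  have outside: "(\<Prod>x\<in>E. edge_weight (\<alpha>' 2 x) (\<beta>' 2 x) (\<sigma>(v0 := t)) (ends G' x)) = R \<sigma>" for \<sigma> t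
    unfolding R_def
  proof (intro prod.cong refl)
    fix x assume x: "x \<in> E"
    have "edge_weight (\<alpha> 2 x) (\<beta> 2 x) (\<sigma>(v0 := t)) (ends G x) =
        edge_weight (\<alpha> 2 x) (\<beta> 2 x) \<sigma> (ends G x)"
      using finite_graph_endsD[OF fin, of x] x v0 by (intro edge_weight_cong) (auto simp: E_def)
    then show "edge_weight (\<alpha>' 2 x) (\<beta>' 2 x) (\<sigma>(v0 := t)) (ends G' x) =
        edge_weight (\<alpha> 2 x) (\<beta> 2 x) \<sigma> (ends G x)"
      using outer[of 2 x] x ends_E[OF x] by (simp add: E_def)
  qed
  have e_mem: "e ` {1..3} \<subseteq> edges G" using tri unfolding is_triangle_def by blast
  have coeffs: "\<alpha> 1 (e i) = p i * \<alpha> 2 (e i) + q i" "\<beta> 1 (e i) = p i * \<beta> 2 (e i) + q i"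
    if "i \<in> {1..3}" for i
    by (rule affine_weight_coeffs[OF assms(10,12,13)[OF that]])+
  have coeffs': "\<alpha>' 1 (s i) = p' i * \<alpha>' 2 (s i) + q' i"
    "\<beta>' 1 (s i) = p' i * \<beta>' 2 (s i) + q' i" if "i \<in> {1..3}" for i
    by (rule affine_weight_coeffs[OF assms(11,14,15)[OF that]])+
  have lhs: "?L = (\<Sum>\<sigma>\<in>S. R \<sigma> * (T 1 \<sigma> - p 1 * p 2 * p 3 * T 2 \<sigma>))"
    unfolding triangle[symmetric] R_def S_def E_def
    by (rule affine_expansion[OF finG(2) is_triangle_inj[OF tri] e_mem]) (rule coeffs assms(16); assumption)+
  have "?R = (\<Sum>\<sigma>\<in>verts G' \<rightarrow>\<^sub>E {..<n}.
      (\<Prod>x\<in>edges G' - s ` {1..3}. edge_weight (\<alpha>' 2 x) (\<beta>' 2 x) \<sigma> (ends G' x)) *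
      (Y 1 \<sigma> - p' 1 * p' 2 * p' 3 * Y 2 \<sigma>))"
    unfolding Y_def
    by (rule affine_expansion[OF finG'(1) inj_s finG'(2)]) (rule coeffs' assms(17); assumption)+
  also have "\<dots> = (\<Sum>\<sigma>\<in>S. \<Sum>t<n. R \<sigma> *
      (Y 1 (\<sigma>(v0 := t)) - p' 1 * p' 2 * p' 3 * Y 2 (\<sigma>(v0 := t))))"
    unfolding G'_simps(1,3) sum_PiE_insert[OF v0] outside S_def ..
  \<comment> \<open>The summand is linear in \<open>Y 1\<close> and \<open>Y 2\<close>, so summing
    over \<open>t\<close> replaces each by its \<open>T\<close>, with the relation applied once per
    model. Both sides then differ only in the products of the \<open>p\<close>'s, which are equal by
    assumption.\<close>
  also have "\<dots> = (\<Sum>\<sigma>\<in>S. R \<sigma> * (T 1 \<sigma> - p' 1 * p' 2 * p' 3 * T 2 \<sigma>))"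
    by (intro sum.cong refl) (simp add: star[symmetric] sum_subtractf sum_distrib_left[symmetric])
  finally show ?thesis unfolding lhs assms(18) by simp
qed

end
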